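(* For every odd prime $p$, $$\varrho(p)=\frac{|\tau(\chi_p)|^2-1}{2}.$$
   Context: $\varphi$ is Euler's totient function, $\omega(n)$ is the number of distinct prime divisors of $n$, and $\varrho(n):=\varphi(n)/2^{\omega(n)}$. For an odd prime $p$, $\tau(\chi_p)=\sum_{a=1}^{p-1}\left(\frac{a}{p}\right)e^{2\pi i a/p}$ is the quadratic Gauss sum, where $\left(\frac{a}{p}\right)$ is the Legendre symbol. *)

theory Defs
  imports "HOL-Analysis.Analysis" "HOL-Number_Theory.Number_Theory"
begin

definition omega :: "nat \<Rightarrow> nat" where
  "omega n = card (prime_factors n)"

definition varrho :: "nat \<Rightarrow> real" where
  "varrho n = real (totient n) / 2 ^ omega n"

definition quadratic_gauss_sum :: "nat \<Rightarrow> complex" where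
  "quadratic_gauss_sum p =
     (\<Sum>a = 1..p - 1. of_int (Legendre (int a) (int p)) * exp (2 * of_real pi * \<i> * of_nat a / of_nat p))"

end

theory Submission
  imports Defs
begin

text \<open>
  Since \<open>omega p = 1\<close> and \<open>totient p = p - 1\<close>, the claim is that the quadratic Gauss sum
  \<open>\<tau>\<close> satisfies \<open>\<bar>\<tau>\<bar>\<^sup>2 = p\<close>. Write \<open>\<chi>\<close> for the Legendre symbol and \<open>w = e\<^bsup>2\<pi>i/p\<^esup>\<close>.
  Multiplication by a unit \<open>b\<close> permutes the nonzero residues, so multiplicativity of \<open>\<chi>\<close>
  turns \<open>\<chi>(b) \<tau>\<close> into \<open>\<Sum>\<^sub>c \<chi>(c) w\<^bsup>bc\<^esup>\<close> (\<open>Legendre_mult_gauss_sum\<close>). Expanding only the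
  conjugated factor of \<open>\<tau> \<cdot> cnj \<tau>\<close> and exchanging the two sums therefore gives
  \<open>\<Sum>\<^sub>c \<chi>(c) \<Sum>\<^sub>b w\<^bsup>b(c-1)\<^esup>\<close>, with \<open>b\<close> and \<open>c\<close> ranging over the nonzero residues. The inner sum
  is a geometric sum over \<open>b = 0, \<dots>, p - 1\<close> with the term for \<open>b = 0\<close> left out: it is
  \<open>p - 1\<close> for \<open>c = 1\<close>, and \<open>-1\<close> otherwise, because then \<open>w\<^bsup>c-1\<^esup> \<noteq> 1\<close>.
  What remains is \<open>p - \<Sum>\<^sub>c \<chi>(c)\<close>, and the last sum vanishes
  because a nonresidue exists (\<open>sum_Legendre_eq_0\<close>).
\<close>

lemma Legendre_cong:
  assumes "[a = b] (mod p)"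
  shows "Legendre a p = Legendre b p"
proof -
  have "[a = 0] (mod p) \<longleftrightarrow> [b = 0] (mod p)" "QuadRes p a \<longleftrightarrow> QuadRes p b"
    unfolding QuadRes_def using assms by (meson cong_trans cong_sym)+
  then show ?thesis by (simp add: Legendre_def)
qed

text \<open>
  By Euler's criterion both sides are congruent modulo \<open>p\<close>; as they lie in \<open>{-1, 0, 1}\<close>,
  they differ by at most \<open>2 < p\<close>, so they are equal.
\<close>

lemma Legendre_mult:
  fixes p :: nat
  assumes "prime p" "odd p"
  shows "Legendre (a * b) (int p) = Legendre a (int p) * Legendre b (int p)"
proof -
  have p2: "2 < p"
    using assms prime_gt_1_nat[of p] by (cases "p = 2") auto
  have euler: "[Legendre x p = x ^ ((p - 1) div 2)] (mod p)" for x :: int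
    using euler_criterion[OF assms(1) p2] by simp
  have "[Legendre a p * Legendre b p = (a * b) ^ ((p - 1) div 2)] (mod p)"
    using cong_mult[OF euler euler] by (simp add: power_mult_distrib)
  then have "[Legendre (a * b) p = Legendre a p * Legendre b p] (mod p)"
    using euler cong_trans cong_sym by blast
  then have "int p dvd Legendre (a * b) p - Legendre a p * Legendre b p"
    by (simp add: cong_iff_dvd_diff)
  moreover have "\<bar>Legendre (a * b) p - Legendre a p * Legendre b p\<bar> < int p"
    using p2 by (auto simp: Legendre_def)
  ultimately show ?thesis
    using dvd_imp_le_int[of "Legendre (a * b) p - Legendre a p * Legendre b p" "int p"] by linarith
qed

lemma Legendre_mult_self:
  assumes "\<not> p dvd a"
  shows "Legendre a p * Legendre a p = 1"
  using assms by (auto simp: Legendre_def cong_0_iff)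

lemma bij_betw_mult_mod_prime:
  fixes p :: nat
  assumes "prime p" "\<not> p dvd b"
  shows "bij_betw (\<lambda>c. b * c mod p) {1..p - 1} {1..p - 1}"
proof -
  have p0: "0 < p" using assms(1) by (simp add: prime_gt_0_nat)
  have cop: "coprime b p"
    using assms prime_imp_coprime coprime_commute by blast
  have "inj_on (\<lambda>c. b * c mod p) {1..p - 1}"
  proof (rule inj_onI)
    fix x y
    assume "x \<in> {1..p - 1}" "y \<in> {1..p - 1}" "b * x mod p = b * y mod p"
    moreover from this have "[x = y] (mod p)"
      using cong_mult_lcancel_nat[OF cop] by (simp add: cong_def)
    ultimately show "x = y"
      using p0 by (intro cong_less_imp_eq_nat[of x p y]) auto
  qed
  moreover have "(\<lambda>c. b * c mod p) ` {1..p - 1} \<subseteq> {1..p - 1}"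
  proof safe
    fix c assume c: "c \<in> {1..p - 1}"
    then have "\<not> p dvd c" using p0 by (auto dest: dvd_imp_le)
    with assms have "\<not> p dvd b * c" by (simp add: prime_dvd_mult_iff)
    then have "b * c mod p \<noteq> 0" by (simp add: dvd_eq_mod_eq_0)
    moreover have "b * c mod p < p" using p0 by simp
    ultimately show "b * c mod p \<in> {1..p - 1}" by auto
  qed
  ultimately show ?thesis
    by (simp add: bij_betw_def endo_inj_surj)
qed

text \<open>
  Squaring on the nonzero residues identifies \<open>1\<close> with \<open>p - 1\<close>, so it is not injective and,
  the set being finite, not surjective either; any residue that it misses will do.
\<close>

lemma quadratic_nonresidue_exists:
  fixes p :: nat
  assumes "prime p" "odd p"
  obtains n where "n \<in> {1..p - 1}" "Legendre (int n) (int p) = -1"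
proof -
  let ?U = "{1..p - 1}" and ?sq = "\<lambda>x. x\<^sup>2 mod p"
  have p2: "2 < p"
    using assms prime_gt_1_nat[of p] by (cases "p = 2") auto
  have "[int (p - 1) ^ 2 = (-1) ^ 2] (mod int p)"
    using p2 by (intro cong_pow) (simp add: cong_iff_dvd_diff of_nat_diff)
  then have "[(p - 1)\<^sup>2 = 1] (mod p)"
    by (simp flip: cong_int_iff)
  then have "?sq 1 = ?sq (p - 1)" by (simp add: cong_def)
  then have "\<not> inj_on ?sq ?U"
    using p2 inj_onD[of ?sq ?U 1 "p - 1"] by fastforce
  then have "\<not> ?U \<subseteq> ?sq ` ?U"
    using finite_surj_inj[of ?U ?sq] by auto
  then obtain n where n: "n \<in> ?U" "n \<notin> ?sq ` ?U" by blast
  have ndvd: "\<not> p dvd n" using n p2 by (auto dest: dvd_imp_le)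
  have "\<not> QuadRes (int p) (int n)"
  proof
    assume "QuadRes (int p) (int n)"
    then obtain y where y: "[y\<^sup>2 = int n] (mod int p)"
      by (auto simp: QuadRes_def)
    define x where "x = nat (y mod int p)"
    have x: "int x = y mod int p" using p2 by (simp add: x_def)
    then have "[int x ^ 2 = y ^ 2] (mod int p)"
      by (intro cong_pow) simp
    then have "[int (x\<^sup>2) = int n] (mod int p)"
      using y cong_trans by simp blast
    then have "[x\<^sup>2 = n] (mod p)" by (simp only: cong_int_iff)
    then have sq: "?sq x = n" using n by (auto simp: cong_def)
    have "x \<noteq> 0" using sq n by (intro notI) auto
    moreover have "int x < int p" unfolding x using p2 by simp
    ultimately have "x \<in> ?U" by auto
    with sq n(2) show False by blast
  qed
  with ndvd have "Legendre (int n) (int p) = -1"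
    by (simp add: Legendre_def cong_0_iff)
  with n that show ?thesis by blast
qed

text \<open>Multiplying the summation variable by a nonresidue changes the sign of the sum.\<close>

lemma sum_Legendre_eq_0:
  fixes p :: nat
  assumes "prime p" "odd p"
  shows "(\<Sum>c = 1..p - 1. Legendre (int c) (int p)) = 0"
proof -
  obtain n where n: "n \<in> {1..p - 1}" "Legendre (int n) (int p) = -1"
    using quadratic_nonresidue_exists[OF assms] .
  then have ndvd: "\<not> p dvd n" by (auto dest: dvd_imp_le)
  have "(\<Sum>c = 1..p - 1. Legendre (int c) (int p))
      = (\<Sum>c = 1..p - 1. Legendre (int (n * c mod p)) (int p))"
    by (rule sum.reindex_bij_betw[OF bij_betw_mult_mod_prime[OF assms(1) ndvd], symmetric])
  also have "\<dots> = (\<Sum>c = 1..p - 1. - Legendre (int c) (int p))"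
  proof (rule sum.cong[OF refl])
    fix c
    have "Legendre (int (n * c mod p)) (int p) = Legendre (int n * int c) (int p)"
      by (rule Legendre_cong) (simp add: cong_def zmod_int)
    then show "Legendre (int (n * c mod p)) (int p) = - Legendre (int c) (int p)"
      by (simp add: Legendre_mult[OF assms] n(2))
  qed
  finally show ?thesis by (simp add: sum_negf)
qed

lemma cis_power_period: "cis (2 * pi / real n) ^ n = 1"
  by (cases "n = 0") (simp_all only: Complex.DeMoivre, simp_all)

lemma power_mod_period:
  fixes w :: "'a :: monoid_mult"
  assumes "w ^ n = 1"
  shows "w ^ (k mod n) = w ^ k"
proof -
  have "w ^ k = w ^ (n * (k div n) + k mod n)" by simp
  also have "\<dots> = w ^ (k mod n)"
    unfolding power_add power_mult assms by simp
  finally show ?thesis by simp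
qed

lemma quadratic_gauss_sum_altdef:
  "quadratic_gauss_sum p =
     (\<Sum>a = 1..p - 1. of_int (Legendre (int a) (int p)) * cis (2 * pi / real p) ^ a)"
  unfolding quadratic_gauss_sum_def Complex.DeMoivre
  unfolding cis_conv_exp
  by (intro sum.cong refl arg_cong2[of _ _ _ _ "(*)"] arg_cong[of _ _ exp]) simp

text \<open>
  Substituting \<open>a = bc\<close> in the Gauss sum produces a factor \<open>\<chi>(b)\<close>, which the factor in front
  cancels since \<open>\<chi>(b)\<^sup>2 = 1\<close>.
\<close>

lemma Legendre_mult_gauss_sum:
  fixes p :: nat
  assumes "prime p" "odd p" "\<not> p dvd b"
  shows "of_int (Legendre (int b) (int p)) * quadratic_gauss_sum p =
     (\<Sum>c = 1..p - 1. of_int (Legendre (int c) (int p)) * cis (2 * pi / real p) ^ (b * c))"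
proof -
  let ?\<chi> = "\<lambda>a. Legendre (int a) (int p)" and ?w = "cis (2 * pi / real p)"
  have "quadratic_gauss_sum p = (\<Sum>c = 1..p - 1. of_int (?\<chi> (b * c mod p)) * ?w ^ (b * c mod p))"
    unfolding quadratic_gauss_sum_altdef
    by (rule sum.reindex_bij_betw[OF bij_betw_mult_mod_prime[OF assms(1,3)], symmetric])
  also have "\<dots> = (\<Sum>c = 1..p - 1. of_int (?\<chi> b) * (of_int (?\<chi> c) * ?w ^ (b * c)))"
  proof (rule sum.cong[OF refl])
    fix c
    have "?\<chi> (b * c mod p) = Legendre (int b * int c) (int p)"
      by (rule Legendre_cong) (simp add: cong_def zmod_int)
    then show "of_int (?\<chi> (b * c mod p)) * ?w ^ (b * c mod p)
        = of_int (?\<chi> b) * (of_int (?\<chi> c) * ?w ^ (b * c))"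
      by (simp add: Legendre_mult[OF assms(1,2)] power_mod_period[OF cis_power_period])
  qed
  also have "\<dots> = of_int (?\<chi> b) * (\<Sum>c = 1..p - 1. of_int (?\<chi> c) * ?w ^ (b * c))"
    by (simp add: sum_distrib_left)
  finally have "of_int (?\<chi> b) * quadratic_gauss_sum p =
      of_int (?\<chi> b * ?\<chi> b) * (\<Sum>c = 1..p - 1. of_int (?\<chi> c) * ?w ^ (b * c))"
    by (simp add: mult.assoc)
  then show ?thesis
    using assms(3) by (simp add: Legendre_mult_self flip: of_int_mult)
qed

lemma sum_nontrivial_powers_root_of_unity:
  fixes v :: "'a :: field"
  assumes "v ^ n = 1" "0 < n"
  shows "(\<Sum>b = 1..n - 1. v ^ b) = (if v = 1 then of_nat n else 0) - 1"
proof -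
  have "{..<n} = insert 0 {1..n - 1}" using assms(2) by auto
  then have "(\<Sum>b<n. v ^ b) = 1 + (\<Sum>b = 1..n - 1. v ^ b)" by simp
  moreover have "(\<Sum>b<n. v ^ b) = (if v = 1 then of_nat n else 0)"
    using assms(1) by (simp add: sum_gp_strict)
  ultimately show ?thesis by simp
qed

theorem norm_quadratic_gauss_sum_squared:
  fixes p :: nat
  assumes "prime p" "odd p"
  shows "(cmod (quadratic_gauss_sum p))\<^sup>2 = real p"
proof -
  let ?\<chi> = "\<lambda>a. complex_of_int (Legendre (int a) (int p))"
  let ?\<tau> = "quadratic_gauss_sum p"
  define w where "w = cis (2 * pi / real p)"
  \<comment> \<open>\<open>cnj w\<close> is the inverse of \<open>w\<close>, so \<open>v c\<close> is \<open>w\<^bsup>c-1\<^esup>\<close>\<close>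
  define v where "v c = w ^ c * cnj w" for c
  have p1: "1 < p" using assms(1) by (rule prime_gt_1_nat)
  have wp: "w ^ p = 1" unfolding w_def by (rule cis_power_period)
  have ww: "w * cnj w = 1" by (simp add: w_def cis_cnj cis_mult)
  have v_root: "v c ^ p = 1" for c
  proof -
    have "v c ^ p = (w ^ p) ^ c * cnj (w ^ p)"
      by (simp add: v_def power_mult_distrib mult.commute flip: power_mult)
    then show ?thesis by (simp add: wp)
  qed
  have v_1: "v c = 1 \<longleftrightarrow> c = 1" if c: "c \<in> {1..p - 1}" for c
  proof
    assume "v c = 1"
    then have "w ^ c * (w * cnj w) = w"
      unfolding v_def by (metis mult.commute mult.left_commute mult.right_neutral)
    then have "w ^ c = w ^ 1" by (simp add: ww)
    moreover have "w ^ k = cis (2 * pi * real k / real p)" for k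
      by (simp only: w_def Complex.DeMoivre) (simp add: mult_ac)
    ultimately have "cis (2 * pi * real c / real p) = cis (2 * pi * real 1 / real p)"
      by metis
    then show "c = 1"
      using bij_betw_imp_inj_on[OF Complex.bij_betw_roots_unity[of p]] c p1
      by (intro inj_onD[of "\<lambda>k. cis (2 * pi * real k / real p)" "{..<p}" c 1]) auto
  qed (use ww in \<open>simp add: v_def\<close>)
  have v_sum: "(\<Sum>b = 1..p - 1. v c ^ b) = (if c = 1 then of_nat p else 0) - 1"
    if "c \<in> {1..p - 1}" for c
    using sum_nontrivial_powers_root_of_unity[OF v_root] v_1[OF that] p1 by simp

  have "?\<tau> * cnj ?\<tau> = (\<Sum>b = 1..p - 1. (?\<chi> b * ?\<tau>) * cnj w ^ b)"
    by (subst (2) quadratic_gauss_sum_altdef, fold w_def)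
       (simp add: sum_distrib_left mult_ac)
  also have "\<dots> = (\<Sum>b = 1..p - 1. \<Sum>c = 1..p - 1. ?\<chi> c * v c ^ b)"
  proof (rule sum.cong[OF refl])
    fix b assume "b \<in> {1..p - 1}"
    then have "\<not> p dvd b" by (auto dest: dvd_imp_le)
    from Legendre_mult_gauss_sum[OF assms this, folded w_def]
    show "(?\<chi> b * ?\<tau>) * cnj w ^ b = (\<Sum>c = 1..p - 1. ?\<chi> c * v c ^ b)"
      by (simp add: v_def sum_distrib_left power_mult_distrib mult_ac flip: power_mult)
  qed
  also have "\<dots> = (\<Sum>c = 1..p - 1. ?\<chi> c * (\<Sum>b = 1..p - 1. v c ^ b))"
    by (subst sum.swap) (simp add: sum_distrib_left)
  also have "\<dots> = (\<Sum>c = 1..p - 1. (if c = 1 then ?\<chi> c * of_nat p else 0) - ?\<chi> c)"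
    by (intro sum.cong refl) (simp only: v_sum, simp add: algebra_simps)
  also have "\<dots> = ?\<chi> 1 * of_nat p - of_int (\<Sum>c = 1..p - 1. Legendre (int c) (int p))"
    using p1 by (simp add: sum_subtractf)
  also have "\<dots> = ?\<chi> 1 * of_nat p"
    by (simp only: sum_Legendre_eq_0[OF assms]) simp
  also have "?\<chi> 1 = 1"
    using p1 by (auto simp: Legendre_def QuadRes_def cong_0_iff intro: exI[of _ 1])
  finally have "complex_of_real ((cmod ?\<tau>)\<^sup>2) = complex_of_real (real p)"
    by (simp only: complex_norm_square) simp
  then show ?thesis by (simp only: of_real_eq_iff)
qed

theorem proposition5p5:
  fixes p :: nat
  assumes "prime p" and "odd p"
  shows "varrho p = ((cmod (quadratic_gauss_sum p))\<^sup>2 - 1) / 2"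
proof -
  have "omega p = 1"
    using assms(1) by (simp add: omega_def prime_prime_factors)
  moreover have "real (totient p) = real p - 1"
    using assms(1) prime_gt_0_nat[of p] by (simp add: totient_prime of_nat_diff)
  ultimately show ?thesis
    by (simp add: varrho_def norm_quadratic_gauss_sum_squared[OF assms])
qed

end
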